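(* Assume that $s_{i,\min}$, $u_{i,\max}$ and $D'_{i,\max}-D'_{i,\min}$ are identical for all $i\in\mathcal{E}$, and that $C'_{i,\max}-C'_{i,\min}$ is the same for all phases. Suppose that Algorithm 1 (defined in the context) is used with control parameters $V_i=V_{i,\max}$, where $$V_{i,\max}=\frac{s_{i,\max}-s_{i,\min}-2u_{i,\max}}{p_{\max}-p_{\min}+D'_{i,\max}-D'_{i,\min}+C'_{i,\max}-C'_{i,\min}},$$ and that the total energy storage capacity $\sum_{i\in\mathcal{E}}s_{i,\max}$ is fixed. Then the upper bound $\sum_{i\in\mathcal{E}}\frac{u_{i,\max}^2}{2V_i}$ on the performance gap $w^*-w^{\mathrm{opt}}$ of Algorithm 1, viewed as a function of the allocation $(s_{i,\max})_{i\in\mathcal{E}}$, is minimized when the energy storage capacity is equally allocated, i.e. when $s_{i,\max}$ is the same for all $i\in\mathcal{E}$.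
   Context: Setting (ideal storage). There are $N\ge 2$ phases, and $\mathcal{E}\subseteq\{1,\dots,N\}$ is the set of phases with storage. At time $t\in\{0,1,\dots\}$ phase $i$ has uncontrollable flow $r_{i,t}\in[r_{i,\min},r_{i,\max}]$, controllable flow $l_{i,t}\in\mathbb{R}$, net charging amount $u_{i,t}$ and flow $f_{i,t}$ to/from the substation; the price is $p_t\in[p_{\min},p_{\max}]$; storage $i\in\mathcal{E}$ has energy state $s_{i,t}$, required to lie in $[s_{i,\min},s_{i,\max}]$, with $s_{i,t+1}=s_{i,t}+u_{i,t}$. The per-slot constraints are: $|u_{i,t}|\le u_{i,\max}$ for $i\in\mathcal{E}$, $u_{i,t}=0$ for $i\notin\mathcal{E}$, $\mathbf{f}_t=(f_{1,t},\dots,f_{N,t})\in\mathcal{F}$ (a non-empty compact convex subset of $\mathbb{R}^N$), and $f_{i,t}+r_{i,t}+l_{i,t}-u_{i,t}=0$ for all $i$. The functions $C_i,D_i,F:\mathbb{R}\to\mathbb{R}$ are convex and continuously differentiable. With $\overline{f}_t=\frac1N\sum_j f_{j,t}$ the system cost is $w_t=\sum_{i\in\mathcal{E}}[p_tu_{i,t}+D_i(u_{i,t})]+\sum_{i=1}^N[C_i(l_{i,t})+F(f_{i,t}-\overline{f}_t)]$. $[D'_{i,\min},D'_{i,\max}]$ is the range of $D_i'$ on $[-u_{i,\max},u_{i,\max}]$, and $[C'_{i,\min},C'_{i,\max}]$ is the range of $C_i'$ over the feasible values of $l_i$, i.e. $l_i=u_i-f_i-r_i$ with $u_i$, $\mathbf{f}$,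 $r_i$ in their allowed sets; these do not depend on $s_{i,\max}$. The allocations considered are those with $s_{i,\max}-s_{i,\min}-2u_{i,\max}>0$ for all $i\in\mathcal{E}$, and the denominator of $V_{i,\max}$ is positive, so that $V_{i,\max}>0$. Algorithm 1: with $\beta_i=s_{i,\min}+u_{i,\max}+V_i(p_{\max}+D'_{i,\max}+C'_{i,\max})$, at each $t$ take an optimal solution of: minimize $w_t+\sum_{i\in\mathcal{E}}\frac{(s_{i,t}-\beta_i)u_{i,t}}{V_i}$ over $(\mathbf{l}_t,\mathbf{u}_t,\mathbf{f}_t)$ subject to the per-slot constraints, and update $s_{i,t+1}=s_{i,t}+u_{i,t}$. Here $w^*$ is the long-run average expected cost $\limsup_{T\to\infty}\frac1T\sum_{t=0}^{T-1}\mathbb{E}[w_t]$ under Algorithm 1 and $w^{\mathrm{opt}}$ is its optimal value over all control policies satisfying the per-slot constraints and $s_{i,\min}\le s_{i,t}\le s_{i,\max}$ for all $i\in\mathcal{E}$ and $t$. The quantity $\sum_{i\in\mathcal{E}}\frac{u_{i,\max}^2}{2V_i}$ is an upper bound for $w^*-w^{\mathrm{opt}}$ when the system states $[\mathbf{r}_t,p_t]$ are i.i.d. over time. *)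

theory Defs
  imports "HOL-Probability.Probability"
begin

text \<open>
  The phases are the elements of the finite type \<open>'n\<close>, so \<open>N = CARD('n)\<close>. The record holds all data
  except the upper energy limits (the allocation), which are a separate argument because they vary.
  Per-storage data (\<open>smin\<close>, \<open>umax\<close>, \<open>dcost\<close>) are total functions whose values off \<open>storage\<close> are
  never used; \<open>ccost\<close>, \<open>dcost\<close>, \<open>fcost\<close> are the functions \<open>C\<close>, \<open>D\<close>, \<open>F\<close> and \<open>flows\<close> is the set of
  admissible substation flows.
\<close>

record 'n grid =
  storage :: "'n set"
  smin :: "'n \<Rightarrow> real"
  umax :: "'n \<Rightarrow> real"
  rmin :: "'n \<Rightarrow> real"
  rmax :: "'n \<Rightarrow> real"
  pmin :: real
  pmax :: real
  flows :: "(real ^ 'n) set"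
  ccost :: "'n \<Rightarrow> real \<Rightarrow> real"
  dcost :: "'n \<Rightarrow> real \<Rightarrow> real"
  fcost :: "real \<Rightarrow> real"

definition convex_C1 :: "(real \<Rightarrow> real) \<Rightarrow> bool" where
  "convex_C1 g \<longleftrightarrow>
     convex_on UNIV g \<and> g differentiable_on UNIV \<and> continuous_on UNIV (deriv g)"

definition valid_grid :: "'n::finite grid \<Rightarrow> bool" where
  "valid_grid S \<longleftrightarrow>
     2 \<le> CARD('n) \<and>
     (\<forall>i\<in>storage S. 0 \<le> umax S i) \<and>
     (\<forall>i. rmin S i \<le> rmax S i) \<and>
     pmin S \<le> pmax S \<and>
     flows S \<noteq> {} \<and> compact (flows S) \<and> convex (flows S) \<and>
     (\<forall>i. convex_C1 (ccost S i)) \<and>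
     (\<forall>i\<in>storage S. convex_C1 (dcost S i)) \<and>
     convex_C1 (fcost S)"


subsection \<open>Per-slot decisions and cost\<close>

text \<open>A decision is a triple \<open>(l, u, f)\<close>.\<close>

type_synonym 'n decision = "(real ^ 'n) \<times> (real ^ 'n) \<times> (real ^ 'n)"

definition charge :: "'n::finite decision \<Rightarrow> real ^ 'n" where
  "charge x = fst (snd x)"

definition slot_feasible :: "'n::finite grid \<Rightarrow> real ^ 'n \<Rightarrow> 'n decision set" where
  "slot_feasible S r = {(l, u, f).
     (\<forall>i\<in>storage S. \<bar>u $ i\<bar> \<le> umax S i) \<and>
     (\<forall>i. i \<notin> storage S \<longrightarrow> u $ i = 0) \<and>
     f \<in> flows S \<and>
     (\<forall>i. f $ i + r $ i + l $ i - u $ i = 0)}"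

definition mean_flow :: "real ^ 'n::finite \<Rightarrow> real" where
  "mean_flow f = (\<Sum>j\<in>UNIV. f $ j) / real CARD('n)"

definition slot_cost :: "'n::finite grid \<Rightarrow> real \<Rightarrow> 'n decision \<Rightarrow> real" where
  "slot_cost S p = (\<lambda>(l, u, f).
     (\<Sum>i\<in>storage S. p * u $ i + dcost S i (u $ i)) +
     (\<Sum>i\<in>UNIV. ccost S i (l $ i) + fcost S (f $ i - mean_flow f)))"


subsection \<open>Ranges of the marginal costs\<close>

definition D'_max :: "'n::finite grid \<Rightarrow> 'n \<Rightarrow> real" where
  "D'_max S i = Sup (deriv (dcost S i) ` {- umax S i .. umax S i})"

definition D'_min :: "'n::finite grid \<Rightarrow> 'n \<Rightarrow> real" where
  "D'_min S i = Inf (deriv (dcost S i) ` {- umax S i .. umax S i})"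

definition feasible_l :: "'n::finite grid \<Rightarrow> 'n \<Rightarrow> real set" where
  "feasible_l S i = {l $ i | l u f r.
     (\<forall>j. r $ j \<in> {rmin S j .. rmax S j}) \<and> (l, u, f) \<in> slot_feasible S r}"

definition C'_max :: "'n::finite grid \<Rightarrow> 'n \<Rightarrow> real" where
  "C'_max S i = Sup (deriv (ccost S i) ` feasible_l S i)"

definition C'_min :: "'n::finite grid \<Rightarrow> 'n \<Rightarrow> real" where
  "C'_min S i = Inf (deriv (ccost S i) ` feasible_l S i)"


subsection \<open>Allocations and control parameters\<close>

text \<open>An allocation \<open>a\<close> gives the upper energy limits of the storages; \<open>K\<close> is the total capacity.\<close>

definition allocations :: "'n::finite grid \<Rightarrow> real \<Rightarrow> ('n \<Rightarrow> real) set" where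
  "allocations S K =
     {a. (\<forall>i\<in>storage S. a i - smin S i - 2 * umax S i > 0) \<and> (\<Sum>i\<in>storage S. a i) = K}"

definition V_denom :: "'n::finite grid \<Rightarrow> 'n \<Rightarrow> real" where
  "V_denom S i = pmax S - pmin S + D'_max S i - D'_min S i + C'_max S i - C'_min S i"

definition V_max :: "'n::finite grid \<Rightarrow> ('n \<Rightarrow> real) \<Rightarrow> 'n \<Rightarrow> real" where
  "V_max S a i = (a i - smin S i - 2 * umax S i) / V_denom S i"

definition gap_bound :: "'n::finite grid \<Rightarrow> ('n \<Rightarrow> real) \<Rightarrow> real" where
  "gap_bound S V = (\<Sum>i\<in>storage S. (umax S i)\<^sup>2 / (2 * V i))"


subsection \<open>Policies, Algorithm 1 and the performance gap\<close>

text \<open>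
  \<open>G t\<close> is the information available when the decision of slot \<open>t\<close> is taken; it may be larger than
  the history of the states, which allows for randomization. That the states are independent over
  time follows from adaptedness and the independence of each state from the preceding information.
\<close>

definition iid_states ::
  "'n::finite grid \<Rightarrow> 'w measure \<Rightarrow> (nat \<Rightarrow> 'w measure) \<Rightarrow>
   (nat \<Rightarrow> 'w \<Rightarrow> real ^ 'n) \<Rightarrow> (nat \<Rightarrow> 'w \<Rightarrow> real) \<Rightarrow> bool" where
  "iid_states S M G r p \<longleftrightarrow>
     prob_space M \<and> filtration (space M) G \<and> (\<forall>t. sets (G t) \<subseteq> sets M) \<and>
     (\<forall>t. (\<lambda>\<omega>. (r t \<omega>, p t \<omega>)) \<in> borel_measurable (G t)) \<and>
     (\<forall>t. prob_space.indep_set M (sets (G t))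
            {(\<lambda>\<omega>. (r (Suc t) \<omega>, p (Suc t) \<omega>)) -` B \<inter> space M | B. B \<in> sets borel}) \<and>
     (\<forall>t. distr M borel (\<lambda>\<omega>. (r t \<omega>, p t \<omega>)) = distr M borel (\<lambda>\<omega>. (r 0 \<omega>, p 0 \<omega>))) \<and>
     (\<forall>t. \<forall>\<omega>\<in>space M.
        (\<forall>i. r t \<omega> $ i \<in> {rmin S i .. rmax S i}) \<and> p t \<omega> \<in> {pmin S .. pmax S})"

text \<open>Only the coordinates in \<open>storage\<close> are meaningful as energy states.\<close>

primrec energy :: "real ^ 'n::finite \<Rightarrow> (nat \<Rightarrow> 'n decision) \<Rightarrow> nat \<Rightarrow> real ^ 'n" where
  "energy s0 x 0 = s0"
| "energy s0 x (Suc t) = energy s0 x t + charge (x t)"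

definition energy_ok :: "'n::finite grid \<Rightarrow> ('n \<Rightarrow> real) \<Rightarrow> real ^ 'n \<Rightarrow> bool" where
  "energy_ok S a s \<longleftrightarrow> (\<forall>i\<in>storage S. smin S i \<le> s $ i \<and> s $ i \<le> a i)"

definition policies ::
  "'n::finite grid \<Rightarrow> ('n \<Rightarrow> real) \<Rightarrow> real ^ 'n \<Rightarrow> 'w measure \<Rightarrow> (nat \<Rightarrow> 'w measure) \<Rightarrow>
   (nat \<Rightarrow> 'w \<Rightarrow> real ^ 'n) \<Rightarrow> (nat \<Rightarrow> 'w \<Rightarrow> 'n decision) set" where
  "policies S a s0 M G r =
     {x. (\<forall>t. x t \<in> borel_measurable (G t)) \<and>
         (\<forall>t. \<forall>\<omega>\<in>space M. x t \<omega> \<in> slot_feasible S (r t \<omega>) \<and>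
            energy_ok S a (energy s0 (\<lambda>k. x k \<omega>) t))}"

definition beta :: "'n::finite grid \<Rightarrow> ('n \<Rightarrow> real) \<Rightarrow> 'n \<Rightarrow> real" where
  "beta S V i = smin S i + umax S i + V i * (pmax S + D'_max S i + C'_max S i)"

definition alg_objective ::
  "'n::finite grid \<Rightarrow> ('n \<Rightarrow> real) \<Rightarrow> real \<Rightarrow> real ^ 'n \<Rightarrow> 'n decision \<Rightarrow> real" where
  "alg_objective S V p s x =
     slot_cost S p x + (\<Sum>i\<in>storage S. (s $ i - beta S V i) * charge x $ i / V i)"

text \<open>
  Optimal solutions of the per-slot problem need not be unique, so Algorithm 1 is the set of all
  its runs. The energy limits are not constraints of the per-slot problem.
\<close>

definition algorithm1_runs ::
  "'n::finite grid \<Rightarrow> ('n \<Rightarrow> real) \<Rightarrow> real ^ 'n \<Rightarrow> 'w measure \<Rightarrow> (nat \<Rightarrow> 'w measure) \<Rightarrow>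
   (nat \<Rightarrow> 'w \<Rightarrow> real ^ 'n) \<Rightarrow> (nat \<Rightarrow> 'w \<Rightarrow> real) \<Rightarrow> (nat \<Rightarrow> 'w \<Rightarrow> 'n decision) set" where
  "algorithm1_runs S V s0 M G r p =
     {x. (\<forall>t. x t \<in> borel_measurable (G t)) \<and>
         (\<forall>t. \<forall>\<omega>\<in>space M.
            is_arg_min (alg_objective S V (p t \<omega>) (energy s0 (\<lambda>k. x k \<omega>) t))
              (\<lambda>y. y \<in> slot_feasible S (r t \<omega>)) (x t \<omega>))}"

definition avg_cost ::
  "'n::finite grid \<Rightarrow> 'w measure \<Rightarrow> (nat \<Rightarrow> 'w \<Rightarrow> real) \<Rightarrow> (nat \<Rightarrow> 'w \<Rightarrow> 'n decision) \<Rightarrow> ereal" where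
  "avg_cost S M p x =
     limsup (\<lambda>T. ereal ((1 / real T) * (\<Sum>t<T. \<integral>\<omega>. slot_cost S (p t \<omega>) (x t \<omega>) \<partial>M)))"

definition w_opt ::
  "'n::finite grid \<Rightarrow> ('n \<Rightarrow> real) \<Rightarrow> real ^ 'n \<Rightarrow> 'w measure \<Rightarrow> (nat \<Rightarrow> 'w measure) \<Rightarrow>
   (nat \<Rightarrow> 'w \<Rightarrow> real ^ 'n) \<Rightarrow> (nat \<Rightarrow> 'w \<Rightarrow> real) \<Rightarrow> ereal" where
  "w_opt S a s0 M G r p = (INF x\<in>policies S a s0 M G r. avg_cost S M p x)"

end

theory Submission
  imports Defs
begin

text \<open>
  The gap bound is a drift-plus-penalty argument that needs no optimal stationary policy. For a
  fixed energy level, the minimal per-slot objective at the state of slot \<open>k\<close> is at most the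
  objective of any competing policy in slot \<open>k\<close>. Since the states are identically distributed,
  averaging over \<open>k\<close> bounds the expected minimum by the average cost of the competitor: its
  storage terms telescope to a bounded quantity. The energy level reached by Algorithm 1 is
  independent of the current state, so Fubini transfers the bound to its actual objective, and
  the drift of a quadratic Lyapunov function turns it into a bound on the cost. With equal
  denominators the gap bound is a multiple of the sum of the reciprocals of
  \<open>s\<^sub>m\<^sub>a\<^sub>x - s\<^sub>m\<^sub>i\<^sub>n - 2 u\<^sub>m\<^sub>a\<^sub>x\<close>, which is minimal at equal arguments by convexity.
\<close>

section \<open>The per-slot problem over a compact control set\<close>

text \<open>The balance equation determines \<open>l\<close> from the other variables, so for a
  valid grid the free variables range over a compact set that does not depend on the state. Off
  \<open>storage\<close> the box degenerates to the point 0.\<close>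

definition controls :: "'n::finite grid \<Rightarrow> ((real ^ 'n) \<times> (real ^ 'n)) set" where
  "controls S =
     cbox (\<chi> i. if i \<in> storage S then - umax S i else 0) (\<chi> i. if i \<in> storage S then umax S i else 0)
       \<times> flows S"

definition decide :: "real ^ 'n::finite \<Rightarrow> (real ^ 'n) \<times> (real ^ 'n) \<Rightarrow> 'n decision" where
  "decide r z = (fst z - snd z - r, z)"

text \<open>Energy level and state are bundled as \<open>(s, (r, p))\<close>, a pair whose two
  components are independent along a run. Joint measurability and Fubini are used in this
  form.\<close>

definition best_value ::
  "'n::finite grid \<Rightarrow> ('n \<Rightarrow> real) \<Rightarrow> (real ^ 'n) \<times> (real ^ 'n) \<times> real \<Rightarrow> real" where
  "best_value S V q =
     (INF z\<in>controls S. alg_objective S V (snd (snd q)) (fst q) (decide (fst (snd q)) z))"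

text \<open>The weight \<open>1 / (2 * V i)\<close> makes the cross term of the expanded square
  equal to the storage term of \<open>alg_objective\<close>.\<close>

definition lyapunov :: "'n::finite grid \<Rightarrow> ('n \<Rightarrow> real) \<Rightarrow> real ^ 'n \<Rightarrow> real" where
  "lyapunov S V s = (\<Sum>i\<in>storage S. (s $ i - beta S V i)\<^sup>2 / (2 * V i))"

lemma slot_feasible_eq: "slot_feasible S r = decide r ` controls S"
proof (intro set_eqI iffI)
  fix x assume x: "x \<in> slot_feasible S r"
  obtain l u f where xe: "x = (l, u, f)" by (cases x)
  have "(u, f) \<in> controls S"
    using x unfolding xe slot_feasible_def controls_def
    by (auto simp: mem_box_cart abs_le_iff minus_le_iff)
  moreover have "l = u - f - r"
    using x unfolding xe slot_feasible_def by (auto simp: vec_eq_iff algebra_simps add_eq_0_iff)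
  ultimately show "x \<in> decide r ` controls S"
    by (auto simp: xe decide_def intro!: image_eqI[of _ _ "(u, f)"])
next
  fix x assume "x \<in> decide r ` controls S"
  then obtain u f where uf: "(u, f) \<in> controls S" "x = (u - f - r, u, f)"
    by (auto simp: decide_def)
  then have u: "(if i \<in> storage S then - umax S i else 0) \<le> u $ i"
      "u $ i \<le> (if i \<in> storage S then umax S i else 0)" for i
    by (auto simp: controls_def mem_box_cart)
  have "\<bar>u $ i\<bar> \<le> umax S i" if "i \<in> storage S" for i
    using u[of i] that by auto
  moreover have "u $ i = 0" if "i \<notin> storage S" for i
    using u[of i] that by auto
  ultimately show "x \<in> slot_feasible S r"
    using uf by (auto simp: slot_feasible_def controls_def)
qed

lemma charge_bound:
  assumes "x \<in> slot_feasible S r" "i \<in> storage S"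
  shows "\<bar>charge x $ i\<bar> \<le> umax S i"
  using assms by (auto simp: slot_feasible_def charge_def)

lemma compact_controls: "valid_grid S \<Longrightarrow> compact (controls S)"
  unfolding controls_def valid_grid_def by (auto intro!: compact_Times)

lemma controls_nonempty:
  assumes "valid_grid S"
  shows "controls S \<noteq> {}"
proof -
  from assms obtain f where "f \<in> flows S" unfolding valid_grid_def by auto
  then have "(0, f) \<in> controls S"
    using assms by (auto simp: controls_def mem_box_cart valid_grid_def)
  then show ?thesis by blast
qed

lemma convex_C1_continuous: "convex_C1 g \<Longrightarrow> continuous_on A g"
  unfolding convex_C1_def
  using continuous_on_subset[OF differentiable_imp_continuous_on] by blast

text \<open>Projections replace pattern matching, so that the continuity rules apply.\<close>

lemma slot_cost_altdef:
  "slot_cost S p x =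
     (\<Sum>i\<in>storage S. p * charge x $ i + dcost S i (charge x $ i)) +
     (\<Sum>i\<in>UNIV. ccost S i (fst x $ i) +
        fcost S (snd (snd x) $ i - (\<Sum>j\<in>UNIV. snd (snd x) $ j) / real CARD('n)))"
  for S :: "'n::finite grid"
  by (cases x) (simp add: slot_cost_def charge_def mean_flow_def)

lemma continuous_on_charge [continuous_intros]:
  "continuous_on A f \<Longrightarrow> continuous_on A (\<lambda>a. charge (f a))"
  unfolding charge_def by (intro continuous_intros)

lemma continuous_on_decide [continuous_intros]:
  "continuous_on A f \<Longrightarrow> continuous_on A g \<Longrightarrow> continuous_on A (\<lambda>a. decide (f a) (g a))"
  unfolding decide_def by (intro continuous_intros)

lemma continuous_on_slot_cost:
  assumes S: "valid_grid S" and f: "continuous_on A f" and g: "continuous_on A g"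
  shows "continuous_on A (\<lambda>a. slot_cost S (f a) (g a))"
proof -
  have C: "continuous_on UNIV (ccost S i)" for i
    using S by (auto simp: valid_grid_def intro: convex_C1_continuous)
  have D: "continuous_on UNIV (dcost S i)" if "i \<in> storage S" for i
    using S that by (auto simp: valid_grid_def intro: convex_C1_continuous)
  have F: "continuous_on UNIV (fcost S)"
    using S by (auto simp: valid_grid_def intro: convex_C1_continuous)
  show ?thesis
    unfolding slot_cost_altdef
    by (intro continuous_intros f g continuous_on_compose2[OF C] continuous_on_compose2[OF D]
        continuous_on_compose2[OF F]) auto
qed

lemma continuous_on_alg_objective:
  assumes S: "valid_grid S" and f: "continuous_on A f" and g: "continuous_on A g"
    and h: "continuous_on A h"
  shows "continuous_on A (\<lambda>a. alg_objective S V (f a) (g a) (h a))"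
  unfolding alg_objective_def divide_inverse
  by (intro continuous_intros continuous_on_slot_cost S f g h)

text \<open>Prices, states and controls range over compact sets and the cost is continuous. The
  constant is uniform in all three; integrability of the costs rests on it.\<close>

lemma slot_cost_bounded:
  assumes S: "valid_grid S"
  obtains C where "\<And>r p x. (\<And>i. r $ i \<in> {rmin S i .. rmax S i}) \<Longrightarrow> p \<in> {pmin S .. pmax S} \<Longrightarrow>
    x \<in> slot_feasible S r \<Longrightarrow> \<bar>slot_cost S p x\<bar> \<le> C"
proof -
  let ?R = "cbox (\<chi> i. rmin S i) (\<chi> i. rmax S i)"
  let ?g = "\<lambda>(p, r, z). slot_cost S p (decide r z)"
  have "compact ({pmin S .. pmax S} \<times> ?R \<times> controls S)"
    by (intro compact_Times compact_Icc compact_cbox compact_controls S)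
  moreover have "continuous_on A ?g" for A
    unfolding case_prod_unfold by (intro continuous_on_slot_cost S continuous_intros)
  ultimately have "bounded (?g ` ({pmin S .. pmax S} \<times> ?R \<times> controls S))"
    by (intro compact_imp_bounded compact_continuous_image)
  then obtain C where C: "\<And>q. q \<in> {pmin S .. pmax S} \<times> ?R \<times> controls S \<Longrightarrow> \<bar>?g q\<bar> \<le> C"
    by (auto simp: bounded_iff)
  show thesis
  proof
    fix r p x
    assume *: "\<And>i. r $ i \<in> {rmin S i .. rmax S i}" "p \<in> {pmin S .. pmax S}" "x \<in> slot_feasible S r"
    then obtain z where "z \<in> controls S" "x = decide r z" by (auto simp: slot_feasible_eq)
    then show "\<bar>slot_cost S p x\<bar> \<le> C"
      using C[of "(p, r, z)"] * by (auto simp: mem_box_cart)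
  qed
qed

lemma bdd_below_alg_objective:
  assumes "valid_grid S"
  shows "bdd_below ((\<lambda>z. alg_objective S V p s (decide r z)) ` controls S)"
  by (intro bounded_imp_bdd_below compact_imp_bounded compact_continuous_image compact_controls
      continuous_on_alg_objective continuous_intros assms)

lemma best_value_le:
  assumes "valid_grid S" "x \<in> slot_feasible S r"
  shows "best_value S V (s, r, p) \<le> alg_objective S V p s x"
  using assms by (auto simp: slot_feasible_eq best_value_def intro!: cINF_lower bdd_below_alg_objective)

text \<open>Minimizers need not be unique and may depend on extra information, but the value they
  attain is a function of energy level and state only. This lets independence act on it.\<close>

lemma best_value_eq:
  assumes S: "valid_grid S"
    and x: "is_arg_min (alg_objective S V p s) (\<lambda>y. y \<in> slot_feasible S r) x"
  shows "best_value S V (s, r, p) = alg_objective S V p s x"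
proof (rule antisym)
  show "best_value S V (s, r, p) \<le> alg_objective S V p s x"
    using x by (intro best_value_le S) (simp add: is_arg_min_def)
  show "alg_objective S V p s x \<le> best_value S V (s, r, p)"
    unfolding best_value_def using x
    by (intro cINF_greatest controls_nonempty S)
      (auto simp: is_arg_min_def slot_feasible_eq not_less)
qed

text \<open>An infimum of continuous functions is upper semicontinuous, which already gives measurability.\<close>

lemma borel_measurable_best_value:
  assumes S: "valid_grid S"
  shows "best_value S V \<in> borel_measurable borel"
proof (rule borel_measurableI_less)
  fix c
  let ?g = "\<lambda>z q. alg_objective S V (snd (snd q)) (fst q) (decide (fst (snd q)) z)"
  have "{q. best_value S V q < c} = (\<Union>z\<in>controls S. {q. ?g z q < c})"
    unfolding best_value_def
    by (subst cINF_less_iff[OF controls_nonempty[OF S] bdd_below_alg_objective[OF S]]) auto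
  also have "open \<dots>"
    by (intro open_UN ballI open_Collect_less continuous_on_alg_objective S continuous_intros)
  finally show "{q \<in> space borel. best_value S V q < c} \<in> sets borel" by simp
qed

section \<open>Quadratic drift and growth of the energy levels\<close>

text \<open>Expanding the square of \<open>(s $ i - beta S V i) + charge x $ i\<close> gives the old
  term, the storage term of the objective and \<open>(charge x $ i)\<^sup>2 / (2 * V i)\<close>. The
  last is at most the summand of \<open>gap_bound\<close>.\<close>

lemma lyapunov_drift:
  assumes x: "x \<in> slot_feasible S r" and V: "\<And>i. i \<in> storage S \<Longrightarrow> 0 < V i"
  shows "slot_cost S p x + lyapunov S V (s + charge x)
    \<le> alg_objective S V p s x + gap_bound S V + lyapunov S V s"
proof -
  have "(s $ i + charge x $ i - beta S V i)\<^sup>2 / (2 * V i)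
      \<le> (s $ i - beta S V i) * charge x $ i / V i + (umax S i)\<^sup>2 / (2 * V i)
        + (s $ i - beta S V i)\<^sup>2 / (2 * V i)" if i: "i \<in> storage S" for i
  proof -
    have "(charge x $ i)\<^sup>2 \<le> (umax S i)\<^sup>2"
      using charge_bound[OF x i] by (metis abs_le_square_iff abs_of_nonneg order_trans abs_ge_zero)
    with V[OF i] show ?thesis by (simp add: field_simps power2_eq_square)
  qed
  then have "(\<Sum>i\<in>storage S. (s $ i + charge x $ i - beta S V i)\<^sup>2 / (2 * V i))
      \<le> (\<Sum>i\<in>storage S. (s $ i - beta S V i) * charge x $ i / V i + (umax S i)\<^sup>2 / (2 * V i)
        + (s $ i - beta S V i)\<^sup>2 / (2 * V i))"
    by (rule sum_mono)
  then show ?thesis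
    unfolding lyapunov_def gap_bound_def alg_objective_def by (simp add: sum.distrib)
qed

lemma lyapunov_nonneg: "(\<And>i. i \<in> storage S \<Longrightarrow> 0 < V i) \<Longrightarrow> 0 \<le> lyapunov S V s"
  unfolding lyapunov_def by (intro sum_nonneg divide_nonneg_pos) auto

lemma energy_eq_sum: "energy s0 x T = s0 + (\<Sum>t<T. charge (x t))"
  by (induction T) (auto simp: add.assoc)

text \<open>The per-slot problem of Algorithm 1 does not enforce energy limits, so linear growth in
  time is what the charging limits give. For each fixed slot this suffices for
  integrability.\<close>

lemma energy_bound:
  assumes "\<And>t. x t \<in> slot_feasible S (r t)" and i: "i \<in> storage S"
  shows "\<bar>energy s0 x T $ i - s0 $ i\<bar> \<le> real T * umax S i"
proof -
  have "\<bar>energy s0 x T $ i - s0 $ i\<bar> \<le> (\<Sum>t<T. \<bar>charge (x t) $ i\<bar>)"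
    unfolding energy_eq_sum by simp
  also have "\<dots> \<le> (\<Sum>t<T. umax S i)"
    by (intro sum_mono charge_bound[OF assms(1) i])
  finally show ?thesis by simp
qed

section \<open>Integration with an independent variable frozen\<close>

text \<open>Independence makes the joint law of \<open>(X, Y)\<close> the product of the marginal
  laws. By Fubini the expectation is an average over frozen values \<open>s\<close> of
  \<open>X\<close>, and the bound \<open>c\<close> is uniform in \<open>s\<close>.\<close>

lemma (in prob_space) indep_integral_le:
  fixes f :: "_ \<Rightarrow> real"
  assumes [measurable]: "X \<in> measurable M N" "Y \<in> measurable M L" "f \<in> borel_measurable (N \<Otimes>\<^sub>M L)"
    and indep: "\<And>A B. A \<in> sets N \<Longrightarrow> B \<in> sets L \<Longrightarrow>
      prob ((X -` A \<inter> space M) \<inter> (Y -` B \<inter> space M))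
        = prob (X -` A \<inter> space M) * prob (Y -` B \<inter> space M)"
    and int: "integrable M (\<lambda>\<omega>. f (X \<omega>, Y \<omega>))"
    and le: "\<And>s. s \<in> space N \<Longrightarrow> (\<integral>\<omega>. f (s, Y \<omega>) \<partial>M) \<le> c"
  shows "(\<integral>\<omega>. f (X \<omega>, Y \<omega>) \<partial>M) \<le> c"
proof -
  interpret X: prob_space "distr M N X" by (rule prob_space_distr) measurable
  interpret Y: prob_space "distr M L Y" by (rule prob_space_distr) measurable
  interpret XY: pair_prob_space "distr M N X" "distr M L Y" ..
  \<comment> \<open>The product rule fixes the joint law on rectangles, which determines a product
    of sigma-finite measures.\<close>
  have eq: "distr M N X \<Otimes>\<^sub>M distr M L Y = distr M (N \<Otimes>\<^sub>M L) (\<lambda>\<omega>. (X \<omega>, Y \<omega>))"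
  proof (rule pair_measure_eqI)
    fix A B assume AB: "A \<in> sets (distr M N X)" "B \<in> sets (distr M L Y)"
    have "(\<lambda>\<omega>. (X \<omega>, Y \<omega>)) -` (A \<times> B) \<inter> space M = (X -` A \<inter> space M) \<inter> (Y -` B \<inter> space M)"
      by auto
    with AB indep[of A B] show "emeasure (distr M N X) A * emeasure (distr M L Y) B
        = emeasure (distr M (N \<Otimes>\<^sub>M L) (\<lambda>\<omega>. (X \<omega>, Y \<omega>))) (A \<times> B)"
      by (simp add: emeasure_distr emeasure_eq_measure ennreal_mult)
  qed (auto intro: X.sigma_finite_measure_axioms Y.sigma_finite_measure_axioms)
  \<comment> \<open>Joint integrability justifies Fubini and makes the inner integral integrable in
    \<open>s\<close>, as monotonicity of the integral requires.\<close>
  have int': "integrable (distr M N X \<Otimes>\<^sub>M distr M L Y) f"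
    unfolding eq by (subst integrable_distr_eq) (auto intro: int)
  have "(\<integral>\<omega>. f (X \<omega>, Y \<omega>) \<partial>M) = (\<integral>q. f q \<partial>(distr M N X \<Otimes>\<^sub>M distr M L Y))"
    unfolding eq by (subst integral_distr) auto
  also have "\<dots> = (\<integral>s. (\<integral>y. f (s, y) \<partial>distr M L Y) \<partial>distr M N X)"
    by (rule XY.integral_fst'[OF int', symmetric])
  also have "\<dots> \<le> (\<integral>s. c \<partial>distr M N X)"
  proof (rule integral_mono)
    show "integrable (distr M N X) (\<lambda>s. \<integral>y. f (s, y) \<partial>distr M L Y)"
      by (rule XY.integrable_fst'[OF int'])
    fix s assume s: "s \<in> space (distr M N X)"
    then have "(\<integral>y. f (s, y) \<partial>distr M L Y) = (\<integral>\<omega>. f (s, Y \<omega>) \<partial>M)"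
      by (subst integral_distr) auto
    with le[of s] s show "(\<integral>y. f (s, y) \<partial>distr M L Y) \<le> c" by simp
  qed simp
  also have "\<dots> = c" using X.prob_space by simp
  finally show ?thesis .
qed

section \<open>Measurability and integrability under i.i.d. states\<close>

locale iid_grid = prob_space M
  for M :: "'w measure" +
  fixes S :: "'n::finite grid" and G r p
  assumes valid: "valid_grid S" and iid: "iid_states S M G r p"
begin

text \<open>Common ground of \<open>policies\<close> and \<open>algorithm1_runs\<close>. Runs
  satisfy it because a minimizer is feasible.\<close>

definition admissible :: "(nat \<Rightarrow> 'w \<Rightarrow> 'n decision) \<Rightarrow> bool" where
  "admissible x \<longleftrightarrow> (\<forall>t. x t \<in> borel_measurable (G t)) \<and>
     (\<forall>t. \<forall>\<omega>\<in>space M. x t \<omega> \<in> slot_feasible S (r t \<omega>))"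

lemma subalgebra_G: "subalgebra M (G t)"
proof -
  interpret filtration "space M" G using iid by (simp add: iid_states_def)
  show ?thesis using iid by (auto simp: subalgebra_def iid_states_def space_F)
qed

lemma subalgebra_G_mono:
  assumes "s \<le> t"
  shows "subalgebra (G t) (G s)"
proof -
  interpret filtration "space M" G using iid by (simp add: iid_states_def)
  show ?thesis using sets_F_mono[OF assms] by (simp add: subalgebra_def space_F)
qed

lemma measurable_G_imp: "f \<in> measurable (G t) N \<Longrightarrow> f \<in> measurable M N"
  by (rule measurable_from_subalg[OF subalgebra_G])

lemma state_measurable [measurable]: "(\<lambda>\<omega>. (r t \<omega>, p t \<omega>)) \<in> borel_measurable M"
  using iid by (intro measurable_G_imp[of _ t]) (simp add: iid_states_def)

lemma price_measurable [measurable]: "p t \<in> borel_measurable M"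
proof -
  have "(\<lambda>\<omega>. snd (r t \<omega>, p t \<omega>)) \<in> borel_measurable M"
    by (rule measurable_compose[OF state_measurable])
      (intro borel_measurable_continuous_onI continuous_intros)
  then show ?thesis by simp
qed

lemma state_range:
  assumes "\<omega> \<in> space M"
  shows "r t \<omega> $ i \<in> {rmin S i .. rmax S i}" "p t \<omega> \<in> {pmin S .. pmax S}"
  using iid assms unfolding iid_states_def by blast+

lemma
  assumes "admissible x"
  shows admissible_measurable: "x t \<in> borel_measurable M"
    and admissible_feasible: "\<omega> \<in> space M \<Longrightarrow> x t \<omega> \<in> slot_feasible S (r t \<omega>)"
  using assms by (auto simp: admissible_def intro: measurable_G_imp)

lemma slot_cost_measurable [measurable (raw)]:
  assumes [measurable]: "f \<in> borel_measurable N" "g \<in> borel_measurable N"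
  shows "(\<lambda>\<omega>. slot_cost S (f \<omega>) (g \<omega>)) \<in> borel_measurable N"
proof -
  have "(\<lambda>q. slot_cost S (fst q) (snd q)) \<in> borel_measurable borel"
    by (intro borel_measurable_continuous_onI continuous_on_slot_cost valid continuous_intros)
  from measurable_compose[OF borel_measurable_Pair[OF assms] this] show ?thesis by simp
qed

lemma charge_measurable [measurable (raw)]:
  assumes "g \<in> borel_measurable N"
  shows "(\<lambda>\<omega>. charge (g \<omega>) :: real ^ 'n) \<in> borel_measurable N"
proof -
  have "(charge :: 'n decision \<Rightarrow> _) \<in> borel_measurable borel"
    by (intro borel_measurable_continuous_onI continuous_intros)
  from measurable_compose[OF assms this] show ?thesis .
qed

lemma vec_nth_measurable [measurable (raw)]:
  assumes "g \<in> borel_measurable N"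
  shows "(\<lambda>\<omega>. (g \<omega> :: real ^ 'n) $ i) \<in> borel_measurable N"
proof -
  have "(\<lambda>v :: real ^ 'n. v $ i) \<in> borel_measurable borel"
    by (intro borel_measurable_continuous_onI continuous_intros)
  from measurable_compose[OF assms this] show ?thesis .
qed

text \<open>The level in slot \<open>Suc t\<close> uses only decisions up to slot \<open>t\<close>.
  Hence it is known from \<open>G t\<close>, of which the next state is independent.\<close>

lemma energy_measurable_Suc:
  assumes "admissible x"
  shows "(\<lambda>\<omega>. energy s0 (\<lambda>k. x k \<omega>) (Suc t)) \<in> borel_measurable (G t)"
proof -
  have "x k \<in> borel_measurable (G t)" if "k \<le> t" for k
    using assms measurable_from_subalg[OF subalgebra_G_mono[OF that]] by (auto simp: admissible_def)
  then show ?thesis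
    unfolding energy_eq_sum
    by (intro borel_measurable_add borel_measurable_const borel_measurable_sum charge_measurable) auto
qed

lemma energy_measurable:
  assumes "admissible x"
  shows "(\<lambda>\<omega>. energy s0 (\<lambda>k. x k \<omega>) t) \<in> borel_measurable M"
  by (cases t) (use measurable_G_imp[OF energy_measurable_Suc[OF assms]] in auto)

lemma slot_cost_integrable:
  assumes x: "admissible x"
  shows "integrable M (\<lambda>\<omega>. slot_cost S (p t \<omega>) (x t \<omega>))"
proof -
  note [measurable] = admissible_measurable[OF x]
  obtain C where C: "\<And>r p x. (\<And>i. r $ i \<in> {rmin S i .. rmax S i}) \<Longrightarrow> p \<in> {pmin S .. pmax S} \<Longrightarrow>
    x \<in> slot_feasible S r \<Longrightarrow> \<bar>slot_cost S p x\<bar> \<le> C"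
    using slot_cost_bounded[OF valid] by blast
  show ?thesis
  proof (rule integrable_const_bound[where B = C])
    show "AE \<omega> in M. norm (slot_cost S (p t \<omega>) (x t \<omega>)) \<le> C"
      unfolding real_norm_def
      by (auto intro!: AE_I2 C admissible_feasible[OF x] state_range)
  qed measurable
qed

lemma charge_integrable:
  assumes x: "admissible x" and i: "i \<in> storage S"
  shows "integrable M (\<lambda>\<omega>. charge (x t \<omega>) $ i)"
proof -
  note [measurable] = admissible_measurable[OF x]
  show ?thesis
    using charge_bound[OF admissible_feasible[OF x] i]
    by (intro integrable_const_bound[where B = "umax S i"] AE_I2) auto
qed

lemma energy_charge_integrable:
  assumes x: "admissible x" and i: "i \<in> storage S"
  shows "integrable M (\<lambda>\<omega>. (energy s0 (\<lambda>k. x k \<omega>) t $ i - b) * charge (x t \<omega>) $ i / c)"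
proof -
  note [measurable] = admissible_measurable[OF x] energy_measurable[OF x]
  have "\<bar>(energy s0 (\<lambda>k. x k \<omega>) t $ i - b) * charge (x t \<omega>) $ i\<bar>
      \<le> (real t * umax S i + \<bar>s0 $ i - b\<bar>) * umax S i" if "\<omega> \<in> space M" for \<omega>
  proof -
    have "\<bar>energy s0 (\<lambda>k. x k \<omega>) t $ i - b\<bar> \<le> real t * umax S i + \<bar>s0 $ i - b\<bar>"
      using energy_bound[of "\<lambda>k. x k \<omega>" S "\<lambda>k. r k \<omega>", OF admissible_feasible[OF x that] i, of s0 t] by linarith
    then show ?thesis
      unfolding abs_mult using charge_bound[OF admissible_feasible[OF x that] i]
      by (intro mult_mono) auto
  qed
  then have "integrable M (\<lambda>\<omega>. (energy s0 (\<lambda>k. x k \<omega>) t $ i - b) * charge (x t \<omega>) $ i)"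
    by (intro integrable_const_bound[where
          B = "(real t * umax S i + \<bar>s0 $ i - b\<bar>) * umax S i"] AE_I2) auto
  then show ?thesis by simp
qed

lemma alg_objective_integrable:
  assumes x: "admissible x"
  shows "integrable M (\<lambda>\<omega>. alg_objective S V (p t \<omega>) (energy s0 (\<lambda>k. x k \<omega>) t) (x t \<omega>))"
  unfolding alg_objective_def
  by (intro Bochner_Integration.integrable_add slot_cost_integrable x
      Bochner_Integration.integrable_sum energy_charge_integrable)

text \<open>The uniform bound on the slot cost passes to all time averages. Finiteness keeps the
  later subtraction of extended reals away from \<open>\<infinity> - \<infinity>\<close>.\<close>

lemma avg_cost_finite:
  assumes x: "admissible x"
  obtains c where "avg_cost S M p x = ereal c"
proof -
  obtain C where C: "\<And>r p x. (\<And>i. r $ i \<in> {rmin S i .. rmax S i}) \<Longrightarrow> p \<in> {pmin S .. pmax S} \<Longrightarrow>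
    x \<in> slot_feasible S r \<Longrightarrow> \<bar>slot_cost S p x\<bar> \<le> C"
    using slot_cost_bounded[OF valid] by blast
  define E where "E t = (\<integral>\<omega>. slot_cost S (p t \<omega>) (x t \<omega>) \<partial>M)" for t
  have C': "\<bar>slot_cost S (p t \<omega>) (x t \<omega>)\<bar> \<le> C" if "\<omega> \<in> space M" for t \<omega>
    using state_range[OF that] admissible_feasible[OF x that] by (intro C)
  have up: "E t \<le> C" and low: "- C \<le> E t" for t
  proof -
    show "E t \<le> C" unfolding E_def
      using C' by (intro integral_le_const slot_cost_integrable x AE_I2) (auto simp: abs_le_iff)
    show "- C \<le> E t" unfolding E_def
      using C' by (intro integral_ge_const slot_cost_integrable x AE_I2) (auto simp: abs_le_iff minus_le_iff)
  qed
  have "0 \<le> C" using up[of 0] low[of 0] by linarith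
  have "(\<Sum>t<T. E t) \<le> real T * C" for T
    using sum_mono[of "{..<T}" E "\<lambda>_. C"] up by simp
  \<comment> \<open>At \<open>T = 0\<close> the factor \<open>1 / real T\<close> is 0, so the
    average is 0 and the bound holds there by \<open>0 \<le> C\<close>.\<close>
  then have U: "(1 / real T) * (\<Sum>t<T. E t) \<le> C" for T
    using \<open>0 \<le> C\<close> by (cases "T = 0") (auto simp: field_simps)
  have "real T * (- C) \<le> (\<Sum>t<T. E t)" for T
    using sum_mono[of "{..<T}" "\<lambda>_. - C" E] low by simp
  then have L: "- C \<le> (1 / real T) * (\<Sum>t<T. E t)" for T
    using \<open>0 \<le> C\<close> by (cases "T = 0") (auto simp: field_simps)
  have "avg_cost S M p x \<le> ereal C"
    unfolding avg_cost_def E_def[symmetric] using U by (intro Limsup_bounded always_eventually) auto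
  moreover have "ereal (- C) \<le> avg_cost S M p x"
    unfolding avg_cost_def E_def[symmetric] using L
    by (intro le_Limsup always_eventually) auto
  ultimately show thesis
    by (cases "avg_cost S M p x") (auto intro: that)
qed

section \<open>Expected optimal value at a frozen energy level\<close>

lemma indep_next_state:
  assumes X: "X \<in> measurable (G t) N" and A: "A \<in> sets N" and B: "B \<in> sets borel"
  defines "Y \<equiv> \<lambda>\<omega>. (r (Suc t) \<omega>, p (Suc t) \<omega>)"
  shows "prob ((X -` A \<inter> space M) \<inter> (Y -` B \<inter> space M))
    = prob (X -` A \<inter> space M) * prob (Y -` B \<inter> space M)"
proof (rule indep_setD)
  show "indep_set (sets (G t)) {Y -` B \<inter> space M | B. B \<in> sets borel}"
    using iid by (simp add: iid_states_def Y_def)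
  show "X -` A \<inter> space M \<in> sets (G t)"
    using measurable_sets[OF X A] subalgebra_G[of t] by (simp add: subalgebra_def)
qed (use B in auto)

lemma integral_state_eq:
  assumes [measurable]: "f \<in> borel_measurable borel"
  shows "(\<integral>\<omega>. f (r t \<omega>, p t \<omega>) \<partial>M) = (\<integral>\<omega>. (f (r 0 \<omega>, p 0 \<omega>) :: real) \<partial>M)"
proof -
  have "distr M borel (\<lambda>\<omega>. (r t \<omega>, p t \<omega>)) = distr M borel (\<lambda>\<omega>. (r 0 \<omega>, p 0 \<omega>))"
    using iid unfolding iid_states_def by blast
  then have "(\<integral>q. f q \<partial>distr M borel (\<lambda>\<omega>. (r t \<omega>, p t \<omega>)))
      = (\<integral>q. f q \<partial>distr M borel (\<lambda>\<omega>. (r 0 \<omega>, p 0 \<omega>)))" by simp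
  then show ?thesis by (simp add: integral_distr)
qed

text \<open>For fixed \<open>s\<close> the storage term is linear in the bounded charging amounts,
  so the objective is bounded uniformly over feasible decisions. The infimum inherits both bounds
  because a feasible decision exists.\<close>

lemma best_value_integrable: "integrable M (\<lambda>\<omega>. best_value S V (s, r t \<omega>, p t \<omega>))"
proof -
  obtain C where C: "\<And>r p x. (\<And>i. r $ i \<in> {rmin S i .. rmax S i}) \<Longrightarrow> p \<in> {pmin S .. pmax S} \<Longrightarrow>
    x \<in> slot_feasible S r \<Longrightarrow> \<bar>slot_cost S p x\<bar> \<le> C"
    using slot_cost_bounded[OF valid] by blast
  define H where "H = (\<Sum>i\<in>storage S. \<bar>(s $ i - beta S V i) / V i\<bar> * umax S i)"
  have [measurable]: "(\<lambda>q. best_value S V (s, q)) \<in> borel_measurable borel"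
    by (rule measurable_compose[OF _ borel_measurable_best_value[OF valid]])
      (intro borel_measurable_continuous_onI continuous_intros)
  have obj: "\<bar>alg_objective S V (p t \<omega>) s x\<bar> \<le> C + H"
    if "\<omega> \<in> space M" "x \<in> slot_feasible S (r t \<omega>)" for \<omega> x
  proof -
    have "\<bar>\<Sum>i\<in>storage S. (s $ i - beta S V i) / V i * charge x $ i\<bar> \<le> H"
      unfolding H_def
    proof (rule order_trans[OF sum_abs sum_mono])
      fix i assume "i \<in> storage S"
      then show "\<bar>(s $ i - beta S V i) / V i * charge x $ i\<bar> \<le> \<bar>(s $ i - beta S V i) / V i\<bar> * umax S i"
        unfolding abs_mult by (intro mult_left_mono charge_bound[OF that(2)]) auto
    qed
    moreover have "\<bar>slot_cost S (p t \<omega>) x\<bar> \<le> C"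
      using that by (intro C[of "r t \<omega>"] state_range)
    ultimately show ?thesis by (simp add: alg_objective_def)
  qed
  have "\<bar>best_value S V (s, r t \<omega>, p t \<omega>)\<bar> \<le> C + H" if \<omega>: "\<omega> \<in> space M" for \<omega>
  proof -
    have "- (C + H) \<le> best_value S V (s, r t \<omega>, p t \<omega>)"
      unfolding best_value_def using obj[OF \<omega>]
      by (intro cINF_greatest controls_nonempty valid)
        (auto simp: slot_feasible_eq abs_le_iff minus_le_iff)
    moreover obtain x where x: "x \<in> slot_feasible S (r t \<omega>)"
      using controls_nonempty[OF valid] unfolding slot_feasible_eq by blast
    have "best_value S V (s, r t \<omega>, p t \<omega>) \<le> C + H"
      using best_value_le[OF valid x, of V s "p t \<omega>"] obj[OF \<omega> x] by linarith
    ultimately show ?thesis by linarith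
  qed
  then show ?thesis
    by (intro integrable_const_bound[where B = "C + H"] AE_I2) auto
qed

text \<open>
  The energy level \<open>s\<close> is fixed, not that of a run. Averaging the competing policy \<open>y\<close> over time makes its
  mean charging amount vanish, because its energy levels stay bounded.
\<close>

lemma expected_best_value_le:
  assumes y: "y \<in> policies S a s0 M G r" and avg: "avg_cost S M p y = ereal c"
  shows "(\<integral>\<omega>. best_value S V (s, r t \<omega>, p t \<omega>) \<partial>M) \<le> c"
proof -
  have adm: "admissible y" using y by (auto simp: policies_def admissible_def)
  define W where "W T = (\<Sum>k<T. \<integral>\<omega>. slot_cost S (p k \<omega>) (y k \<omega>) \<partial>M)" for T
  define \<phi> where "\<phi> = (\<integral>\<omega>. best_value S V (s, r t \<omega>, p t \<omega>) \<partial>M)"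
  define d where "d i = (s $ i - beta S V i) / V i" for i
  \<comment> \<open>The total charge of a storage is a difference of two energy levels between
    \<open>smin S i\<close> and \<open>a i\<close>, so \<open>H\<close> bounds the accumulated
    storage terms for every horizon.\<close>
  define H where "H = (\<Sum>i\<in>storage S. \<bar>d i\<bar> * (a i - smin S i))"
  have [measurable]: "(\<lambda>q. best_value S V (s, q)) \<in> borel_measurable borel"
    by (rule measurable_compose[OF _ borel_measurable_best_value[OF valid]])
      (intro borel_measurable_continuous_onI continuous_intros)
  have obj: "alg_objective S V (p k \<omega>) s (y k \<omega>)
      = slot_cost S (p k \<omega>) (y k \<omega>) + (\<Sum>i\<in>storage S. d i * charge (y k \<omega>) $ i)" for k \<omega>
    by (simp add: alg_objective_def d_def)
  have int: "integrable M (\<lambda>\<omega>. alg_objective S V (p k \<omega>) s (y k \<omega>))" for k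
    unfolding obj using slot_cost_integrable[OF adm] charge_integrable[OF adm] by auto
  \<comment> \<open>By identical distribution \<open>\<phi>\<close> is the expected minimum in every
    slot \<open>k\<close>, so it can be compared with the decision of \<open>y\<close> in that
    slot.\<close>
  have step: "\<phi> \<le> (\<integral>\<omega>. alg_objective S V (p k \<omega>) s (y k \<omega>) \<partial>M)" for k
  proof -
    have "\<phi> = (\<integral>\<omega>. best_value S V (s, r k \<omega>, p k \<omega>) \<partial>M)"
      unfolding \<phi>_def by (subst (1 2) integral_state_eq) auto
    also have "\<dots> \<le> (\<integral>\<omega>. alg_objective S V (p k \<omega>) s (y k \<omega>) \<partial>M)"
      by (intro integral_mono best_value_integrable int best_value_le valid
          admissible_feasible[OF adm])
    finally show ?thesis .
  qed
  have total: "(\<Sum>k<T. alg_objective S V (p k \<omega>) s (y k \<omega>))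
      \<le> (\<Sum>k<T. slot_cost S (p k \<omega>) (y k \<omega>)) + H" if \<omega>: "\<omega> \<in> space M" for T \<omega>
  proof -
    \<comment> \<open>Since \<open>s\<close> is frozen, \<open>d i\<close> is constant in time and
      leaves the time sum, which then telescopes to the net change of energy.\<close>
    have "(\<Sum>k<T. \<Sum>i\<in>storage S. d i * charge (y k \<omega>) $ i)
        = (\<Sum>i\<in>storage S. d i * (energy s0 (\<lambda>k. y k \<omega>) T $ i - s0 $ i))"
      by (subst sum.swap) (simp add: energy_eq_sum sum_distrib_left)
    also have "\<dots> \<le> H"
      unfolding H_def
    proof (rule sum_mono)
      fix i assume i: "i \<in> storage S"
      have E: "energy_ok S a (energy s0 (\<lambda>k. y k \<omega>) k)" for k
        using y \<omega> by (auto simp: policies_def)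
      \<comment> \<open>The limits hold in slot 0 too, so they cover the initial level
        \<open>s0\<close> as well as the level in slot \<open>T\<close>.\<close>
      have "\<bar>energy s0 (\<lambda>k. y k \<omega>) T $ i - s0 $ i\<bar> \<le> a i - smin S i"
        using E[of T] E[of 0] i unfolding energy_ok_def abs_le_iff by fastforce
      then have "\<bar>d i * (energy s0 (\<lambda>k. y k \<omega>) T $ i - s0 $ i)\<bar> \<le> \<bar>d i\<bar> * (a i - smin S i)"
        unfolding abs_mult by (intro mult_left_mono) auto
      then show "d i * (energy s0 (\<lambda>k. y k \<omega>) T $ i - s0 $ i) \<le> \<bar>d i\<bar> * (a i - smin S i)"
        by linarith
    qed
    finally show ?thesis by (simp add: obj sum.distrib)
  qed
  have "real T * \<phi> \<le> W T + H" for T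
  proof -
    have "real T * \<phi> \<le> (\<Sum>k<T. \<integral>\<omega>. alg_objective S V (p k \<omega>) s (y k \<omega>) \<partial>M)"
      using sum_mono[of "{..<T}" "\<lambda>_. \<phi>"] step by simp
    also have "\<dots> = (\<integral>\<omega>. (\<Sum>k<T. alg_objective S V (p k \<omega>) s (y k \<omega>)) \<partial>M)"
      by (simp add: int)
    also have "\<dots> \<le> (\<integral>\<omega>. (\<Sum>k<T. slot_cost S (p k \<omega>) (y k \<omega>)) + H \<partial>M)"
      by (intro integral_mono total Bochner_Integration.integrable_sum int
          Bochner_Integration.integrable_add slot_cost_integrable adm) auto
    also have "\<dots> = W T + H"
      using slot_cost_integrable[OF adm] by (simp add: W_def prob_space)
    finally show ?thesis .
  qed
  \<comment> \<open>Division by \<open>T\<close> needs \<open>1 \<le> T\<close>; in the limit the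
    contribution \<open>H / real T\<close> disappears.\<close>
  then have "\<phi> \<le> (W T + H) / real T" if "1 \<le> T" for T
    using that by (simp add: pos_le_divide_eq mult.commute)
  then have "\<forall>T\<ge>1. \<phi> - H / real T \<le> (1 / real T) * W T"
    by (auto simp: add_divide_distrib diff_le_eq)
  then have "\<forall>\<^sub>F T in sequentially. ereal (\<phi> - H / real T) \<le> ereal ((1 / real T) * W T)"
    by (auto simp: eventually_sequentially)
  then have "limsup (\<lambda>T. ereal (\<phi> - H / real T)) \<le> avg_cost S M p y"
    unfolding avg_cost_def W_def[symmetric] by (rule Limsup_mono)
  moreover have "(\<lambda>T. \<phi> - H / real T) \<longlonglongrightarrow> \<phi> - 0"
    by (intro tendsto_intros lim_const_over_n)
  then have "limsup (\<lambda>T. ereal (\<phi> - H / real T)) = ereal \<phi>"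
    by (intro lim_imp_Limsup) simp_all
  ultimately show ?thesis using avg by (simp add: \<phi>_def)
qed

section \<open>From the expected objective to the performance gap\<close>

text \<open>Along a run the objective equals \<open>best_value\<close> at the current level and
  state, which are independent, and the bound at a frozen level is uniform in that level. For this
  reason the starting levels \<open>s0\<close> and \<open>s0'\<close> may differ.\<close>

lemma expected_alg_objective_le:
  assumes x: "x \<in> algorithm1_runs S V s0 M G r p"
    and y: "y \<in> policies S a s0' M G r" and avg: "avg_cost S M p y = ereal c"
  shows "(\<integral>\<omega>. alg_objective S V (p t \<omega>) (energy s0 (\<lambda>k. x k \<omega>) t) (x t \<omega>) \<partial>M) \<le> c"
proof -
  have adm: "admissible x"
    using x by (auto simp: algorithm1_runs_def admissible_def is_arg_min_def)
  let ?s = "\<lambda>\<omega>. energy s0 (\<lambda>k. x k \<omega>) t"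
  have eq: "best_value S V (?s \<omega>, r t \<omega>, p t \<omega>) = alg_objective S V (p t \<omega>) (?s \<omega>) (x t \<omega>)"
    if "\<omega> \<in> space M" for \<omega>
    using x that by (intro best_value_eq valid) (auto simp: algorithm1_runs_def)
  have int: "integrable M (\<lambda>\<omega>. best_value S V (?s \<omega>, r t \<omega>, p t \<omega>))"
    using alg_objective_integrable[OF adm] eq
    by (subst Bochner_Integration.integrable_cong[OF refl eq]) auto
  have "(\<integral>\<omega>. best_value S V (?s \<omega>, r t \<omega>, p t \<omega>) \<partial>M) \<le> c"
  proof (cases t)
    \<comment> \<open>In slot 0 the energy level is the constant \<open>s0\<close>, so the bound at
      a frozen level applies directly.\<close>
    case 0
    then show ?thesis using expected_best_value_le[OF y avg] by simp
  next
    case (Suc n)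
    show ?thesis
    proof (rule indep_integral_le[where f = "best_value S V" and N = borel and L = borel])
      show "best_value S V \<in> borel_measurable (borel \<Otimes>\<^sub>M borel)"
        unfolding borel_prod by (rule borel_measurable_best_value[OF valid])
      show "prob ((?s -` A \<inter> space M) \<inter> ((\<lambda>\<omega>. (r t \<omega>, p t \<omega>)) -` B \<inter> space M))
        = prob (?s -` A \<inter> space M) * prob ((\<lambda>\<omega>. (r t \<omega>, p t \<omega>)) -` B \<inter> space M)"
        if "A \<in> sets borel" "B \<in> sets borel" for A B
        unfolding Suc by (rule indep_next_state[OF energy_measurable_Suc[OF adm] that])
    qed (intro int energy_measurable[OF adm] state_measurable expected_best_value_le[OF y avg])+
  qed
  also have "(\<integral>\<omega>. best_value S V (?s \<omega>, r t \<omega>, p t \<omega>) \<partial>M)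
      = (\<integral>\<omega>. alg_objective S V (p t \<omega>) (?s \<omega>) (x t \<omega>) \<partial>M)"
    by (rule Bochner_Integration.integral_cong[OF refl eq])
  finally show ?thesis .
qed

text \<open>Summing the drift over \<open>T\<close> slots cancels all Lyapunov values but the first
  and the last. Each expected objective is at most the average cost of \<open>y\<close>, each slot
  adds \<open>gap_bound S V\<close>, and the initial value vanishes after division by
  \<open>T\<close>.\<close>

lemma avg_cost_algorithm1_le:
  assumes x: "x \<in> algorithm1_runs S V s0 M G r p" and V: "\<And>i. i \<in> storage S \<Longrightarrow> 0 < V i"
    and y: "y \<in> policies S a s0' M G r"
  shows "avg_cost S M p x \<le> avg_cost S M p y + ereal (gap_bound S V)"
proof -
  have adm: "admissible x"
    using x by (auto simp: algorithm1_runs_def admissible_def is_arg_min_def)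
  have "admissible y" using y by (auto simp: policies_def admissible_def)
  then obtain c where c: "avg_cost S M p y = ereal c" by (rule avg_cost_finite)
  let ?s = "\<lambda>t \<omega>. energy s0 (\<lambda>k. x k \<omega>) t"
  let ?obj = "\<lambda>t \<omega>. alg_objective S V (p t \<omega>) (?s t \<omega>) (x t \<omega>)"
  define b where "b = gap_bound S V"
  define L where "L = lyapunov S V s0"
  define W where "W T = (\<Sum>k<T. \<integral>\<omega>. slot_cost S (p k \<omega>) (x k \<omega>) \<partial>M)" for T
  \<comment> \<open>The final Lyapunov value stays on the left so that the induction closes;
    \<open>lyapunov_nonneg\<close> discards it afterwards.\<close>
  have drift: "(\<Sum>t<T. slot_cost S (p t \<omega>) (x t \<omega>)) + lyapunov S V (?s T \<omega>)
      \<le> (\<Sum>t<T. ?obj t \<omega>) + real T * b + L" if \<omega>: "\<omega> \<in> space M" for T \<omega>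
  proof (induction T)
    case (Suc T)
    with lyapunov_drift[where V = V, OF admissible_feasible[OF adm \<omega>, of T] V, of "p T \<omega>" "?s T \<omega>"]
    show ?case by (simp add: b_def algebra_simps)
  qed (simp add: L_def)
  have "W T \<le> real T * (c + b) + L" for T
  proof -
    have "W T = (\<integral>\<omega>. (\<Sum>t<T. slot_cost S (p t \<omega>) (x t \<omega>)) \<partial>M)"
      using slot_cost_integrable[OF adm] by (simp add: W_def)
    also have "\<dots> \<le> (\<integral>\<omega>. (\<Sum>t<T. ?obj t \<omega>) + (real T * b + L) \<partial>M)"
    proof (intro integral_mono Bochner_Integration.integrable_sum slot_cost_integrable
          Bochner_Integration.integrable_add alg_objective_integrable adm integrable_const)
      fix \<omega> assume "\<omega> \<in> space M"
      then show "(\<Sum>t<T. slot_cost S (p t \<omega>) (x t \<omega>)) \<le> (\<Sum>t<T. ?obj t \<omega>) + (real T * b + L)"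
        using drift[of \<omega> T] lyapunov_nonneg[of S V "?s T \<omega>"] V by auto
    qed
    also have "\<dots> = (\<Sum>t<T. \<integral>\<omega>. ?obj t \<omega> \<partial>M) + (real T * b + L)"
      using alg_objective_integrable[OF adm] by (simp add: prob_space)
    also have "(\<Sum>t<T. \<integral>\<omega>. ?obj t \<omega> \<partial>M) \<le> real T * c"
      using sum_mono[of "{..<T}" _ "\<lambda>_. c"] expected_alg_objective_le[OF x y c] by simp
    finally show ?thesis by (simp add: algebra_simps)
  qed
  then have "\<forall>T\<ge>1. (1 / real T) * W T \<le> c + b + L / real T"
    by (simp add: field_simps)
  then have "\<forall>\<^sub>F T in sequentially. ereal ((1 / real T) * W T) \<le> ereal (c + b + L / real T)"
    by (auto simp: eventually_sequentially)
  then have "avg_cost S M p x \<le> limsup (\<lambda>T. ereal (c + b + L / real T))"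
    unfolding avg_cost_def W_def[symmetric] by (rule Limsup_mono)
  moreover have "(\<lambda>T. c + b + L / real T) \<longlonglongrightarrow> c + b + 0"
    by (intro tendsto_intros lim_const_over_n)
  then have "limsup (\<lambda>T. ereal (c + b + L / real T)) = ereal (c + b)"
    by (intro lim_imp_Limsup) simp_all
  ultimately show ?thesis by (simp add: c b_def)
qed

lemma performance_gap_le:
  assumes x: "x \<in> algorithm1_runs S V s0 M G r p" and V: "\<And>i. i \<in> storage S \<Longrightarrow> 0 < V i"
  shows "avg_cost S M p x - w_opt S a s0' M G r p \<le> ereal (gap_bound S V)"
proof -
  have "admissible x"
    using x by (auto simp: algorithm1_runs_def admissible_def is_arg_min_def)
  then obtain e where e: "avg_cost S M p x = ereal e" by (rule avg_cost_finite)
  have "ereal (e - gap_bound S V) \<le> w_opt S a s0' M G r p"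
    unfolding w_opt_def
  proof (rule INF_greatest)
    fix y assume "y \<in> policies S a s0' M G r"
    from avg_cost_algorithm1_le[OF x V this] show "ereal (e - gap_bound S V) \<le> avg_cost S M p y"
      unfolding e by (cases "avg_cost S M p y") auto
  qed
  \<comment> \<open>The lower bound excludes \<open>-\<infinity>\<close>. If there is no policy,
    \<open>w_opt\<close> is \<open>\<infinity>\<close> and the difference is
    \<open>-\<infinity>\<close>.\<close>
  then show ?thesis
    unfolding e by (cases "w_opt S a s0' M G r p") auto
qed

end

section \<open>Optimality of the equal allocation\<close>

text \<open>Up to the factor \<open>u\<^sup>2 * d / 2\<close> the bound is the sum of
  \<open>1 / z i\<close> for positive numbers \<open>z i\<close> with a fixed sum. Replacing
  \<open>1 / z\<close> by its tangent at the common value \<open>z0\<close> bounds each summand from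
  below, and the linear parts cancel in the sum.\<close>

lemma equal_allocation_optimal:
  fixes S :: "'n::finite grid"
  assumes denom: "\<And>i. i \<in> storage S \<Longrightarrow> V_denom S i = d" "0 < d"
    and smin: "\<And>i. i \<in> storage S \<Longrightarrow> smin S i = m"
    and umax: "\<And>i. i \<in> storage S \<Longrightarrow> umax S i = u"
    and b: "\<And>i. i \<in> storage S \<Longrightarrow> b i = b0" "(\<Sum>i\<in>storage S. b i) = K"
    and a: "a \<in> allocations S K"
  shows "b \<in> allocations S K" "gap_bound S (V_max S b) \<le> gap_bound S (V_max S a)"
proof -
  define z0 where "z0 = b0 - m - 2 * u"
  define z where "z i = a i - m - 2 * u" for i
  have z: "0 < z i" if "i \<in> storage S" for i
    using a that smin[OF that] umax[OF that] by (auto simp: allocations_def z_def)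
  have sum_z: "(\<Sum>i\<in>storage S. z i) = (\<Sum>i\<in>storage S. z0)"
    using a b by (simp add: allocations_def z_def z0_def sum_subtractf right_diff_distrib)
  \<comment> \<open>\<open>z0\<close> is the mean of the positive numbers \<open>z i\<close>; the
    element \<open>i\<close> guarantees that there is at least one.\<close>
  have z0: "0 < z0" if "i \<in> storage S" for i
  proof -
    have "0 < (\<Sum>i\<in>storage S. z i)"
      using that z by (intro sum_pos) auto
    then show ?thesis unfolding sum_z by (simp add: zero_less_mult_iff)
  qed
  show "b \<in> allocations S K"
    using b z0 smin umax by (auto simp: allocations_def z0_def)
  \<comment> \<open>The convex function \<open>1 / z\<close> lies above its tangent at
    \<open>z0\<close>; the difference is a square over a positive number.\<close>
  have tangent: "1 / z0 + (z0 - z i) / z0\<^sup>2 \<le> 1 / z i" if i: "i \<in> storage S" for i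
  proof -
    have "1 / z i - (1 / z0 + (z0 - z i) / z0\<^sup>2) = (z i - z0)\<^sup>2 / (z i * z0\<^sup>2)"
      using z[OF i] z0[OF i] by (simp add: field_simps power2_eq_square)
    also have "\<dots> \<ge> 0" using z[OF i] by simp
    finally show ?thesis by simp
  qed
  have gap: "gap_bound S (V_max S f) = u\<^sup>2 * d / 2 * (\<Sum>i\<in>storage S. 1 / (f i - m - 2 * u))" for f
    unfolding gap_bound_def V_max_def sum_distrib_left
    by (intro sum.cong) (auto simp: denom smin umax)
  \<comment> \<open>The linear terms sum to 0 because both allocations have the same total
    \<open>K\<close>.\<close>
  have "(\<Sum>i\<in>storage S. 1 / z0) = (\<Sum>i\<in>storage S. 1 / z0 + (z0 - z i) / z0\<^sup>2)"
    using sum_z by (simp add: sum.distrib sum_divide_distrib[symmetric] sum_subtractf)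
  also have "\<dots> \<le> (\<Sum>i\<in>storage S. 1 / z i)"
    by (rule sum_mono[OF tangent])
  finally have "u\<^sup>2 * d / 2 * (\<Sum>i\<in>storage S. 1 / z0) \<le> u\<^sup>2 * d / 2 * (\<Sum>i\<in>storage S. 1 / z i)"
    using denom(2) by (intro mult_left_mono) auto
  then show "gap_bound S (V_max S b) \<le> gap_bound S (V_max S a)"
    unfolding gap z_def using b(1) by (simp add: z0_def)
qed

theorem proposition2:
  fixes S :: "'n::finite grid" and K :: real
  assumes valid: "valid_grid S"
    and denom_pos: "\<forall>i\<in>storage S. V_denom S i > 0"
    and smin_eq: "\<forall>i\<in>storage S. \<forall>j\<in>storage S. smin S i = smin S j"
    and umax_eq: "\<forall>i\<in>storage S. \<forall>j\<in>storage S. umax S i = umax S j"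
    and D'_eq: "\<forall>i\<in>storage S. \<forall>j\<in>storage S. D'_max S i - D'_min S i = D'_max S j - D'_min S j"
    and C'_eq: "\<forall>i j. C'_max S i - C'_min S i = C'_max S j - C'_min S j"
    and alloc: "allocations S K \<noteq> {}"
  shows
    "(\<forall>a\<in>allocations S K.
        \<forall>(M :: 'w measure) G r p s0. iid_states S M G r p \<longrightarrow> energy_ok S a s0 \<longrightarrow>
          (\<forall>x\<in>algorithm1_runs S (V_max S a) s0 M G r p.
             avg_cost S M p x - w_opt S a s0 M G r p \<le> ereal (gap_bound S (V_max S a)))) \<and>
     (\<forall>b. (\<Sum>i\<in>storage S. b i) = K \<longrightarrow> (\<forall>i\<in>storage S. \<forall>j\<in>storage S. b i = b j) \<longrightarrow>
        is_arg_min (\<lambda>a. gap_bound S (V_max S a)) (\<lambda>a. a \<in> allocations S K) b)"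
proof (intro conjI ballI allI impI)
  fix a :: "'n \<Rightarrow> real" and M :: "'w measure" and G r p s0 x
  assume a: "a \<in> allocations S K" and iid: "iid_states S M G r p"
    and x: "x \<in> algorithm1_runs S (V_max S a) s0 M G r p"
  interpret prob_space M using iid unfolding iid_states_def by blast
  interpret iid_grid M S G r p by unfold_locales (rule valid, rule iid)
  show "avg_cost S M p x - w_opt S a s0 M G r p \<le> ereal (gap_bound S (V_max S a))"
    using a denom_pos by (intro performance_gap_le[OF x]) (auto simp: V_max_def allocations_def)
next
  fix b :: "'n \<Rightarrow> real"
  assume sum_b: "(\<Sum>i\<in>storage S. b i) = K" and eq_b: "\<forall>i\<in>storage S. \<forall>j\<in>storage S. b i = b j"
  have const: "\<exists>c. \<forall>i\<in>storage S. f i = c" if "\<forall>i\<in>storage S. \<forall>j\<in>storage S. f i = f j"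
    for f :: "'n \<Rightarrow> real"
    using that by metis
  have "V_denom S i = V_denom S j" if "i \<in> storage S" "j \<in> storage S" for i j
  proof -
    have "D'_max S i - D'_min S i = D'_max S j - D'_min S j" using D'_eq that by blast
    moreover have "C'_max S i - C'_min S i = C'_max S j - C'_min S j" using C'_eq by blast
    ultimately show ?thesis by (simp add: V_denom_def)
  qed
  \<comment> \<open>If \<open>storage S\<close> is empty, any positive number will do;
    \<open>zero_less_one\<close> supplies 1.\<close>
  then obtain d where d: "\<And>i. i \<in> storage S \<Longrightarrow> V_denom S i = d" "0 < d"
    using denom_pos by (metis zero_less_one)
  obtain m where m: "\<And>i. i \<in> storage S \<Longrightarrow> smin S i = m" using const[OF smin_eq] by blast
  obtain u where u: "\<And>i. i \<in> storage S \<Longrightarrow> umax S i = u" using const[OF umax_eq] by blast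
  obtain b0 where b0: "\<And>i. i \<in> storage S \<Longrightarrow> b i = b0" using const[OF eq_b] by blast
  note opt = equal_allocation_optimal[OF d m u b0 sum_b]
  \<comment> \<open>Comparison with some existing allocation shows that \<open>b\<close> is itself
    an allocation.\<close>
  from alloc obtain a where "a \<in> allocations S K" by blast
  then show "is_arg_min (\<lambda>a. gap_bound S (V_max S a)) (\<lambda>a. a \<in> allocations S K) b"
    using opt by (force simp: is_arg_min_def not_less)
qed

end
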